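(* For $\rho>0$ let $c(\rho)=\sqrt{\rho/(1+\rho)}$ and $s(\rho)=\sqrt{1/(1+\rho)}$. For $\vartheta\in\mathbb R$ and $\star\in\{F,O,N\}$ put $$\mathcal L_\star(\rho,\vartheta)=\left\|\begin{bmatrix}\rho-\vartheta c^2(\rho)&-\vartheta c(\rho)s(\rho)\\-\vartheta c(\rho)s(\rho)&-\vartheta s^2(\rho)\end{bmatrix}\right\|_\star,$$ and $\mathcal L^1_\star(\rho)=\min_{\vartheta\in\mathbb R}\mathcal L_\star(\rho,\vartheta)$. Then for every $\rho>0$ the minimum is attained at $\vartheta=\eta^*(\rho|\star)$, where $$\eta^*(\rho|F)=\frac{\rho^2}{1+\rho},\qquad\eta^*(\rho|O)=\rho,\qquad\eta^*(\rho|N)=\rho\Big(\frac{\rho-1}{\rho+1}\Big)_+,$$ and the minimal values are $$[\mathcal L_F^1(\rho)]^2=\frac{\rho^2(2\rho+1)}{(\rho+1)^2},\qquad\mathcal L_O^1(\rho)=\frac{\rho}{(1+\rho)^{1/2}},\qquad\mathcal L_N^1(\rho)=\begin{cases}\rho&\rho\le1\\[2pt]\dfrac{2\rho\sqrt\rho}{\rho+1}&\rho>1\end{cases}.$$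
   Context: $\|\cdot\|_F,\|\cdot\|_O,\|\cdot\|_N$ denote the Frobenius, operator (spectral) and nuclear matrix norms. $x_+=\max(x,0)$. The function $\mathcal L_\star(\rho,\vartheta)$ is the asymptotic rank-one loss of eigenvalue shrinkage in the spiked covariance model as $p/n\to\infty$, and $\mathcal L_\star^1$, $\eta^*(\cdot|\star)$ are called the formally optimal asymptotic loss and a formally optimal shrinker. *)

theory Defs
  imports "HOL-Analysis.Analysis" "HOL-Computational_Algebra.Polynomial"
begin

definition frobenius_norm :: "real^'n^'m \<Rightarrow> real" where
  "frobenius_norm A = sqrt (\<Sum>i\<in>UNIV. \<Sum>j\<in>UNIV. (A $ i $ j)\<^sup>2)"

text \<open>The norm on \<open>real^'n\<close> is the Euclidean one, so this is the spectral norm.\<close>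

definition operator_norm :: "real^'n^'m \<Rightarrow> real" where
  "operator_norm A = onorm (\<lambda>v. A *v v)"

definition charpoly :: "real^'n^'n \<Rightarrow> real poly" where
  "charpoly A = det (\<chi> i j. (if i = j then [:0, 1:] else 0) - [:A $ i $ j:])"

text \<open>
  The singular values are the square roots of the eigenvalues of \<open>A\<^sup>T A\<close>, taken with
  multiplicity; for a matrix with more columns than rows this merely adds zeros. The
  eigenvalues of the symmetric matrix \<open>A\<^sup>T A\<close> are all real and nonnegative, so the
  real roots of the characteristic polynomial give all of them.
\<close>

definition singular_values :: "real^'n^'m \<Rightarrow> real multiset" where
  "singular_values A = image_mset sqrt (proots (charpoly (transpose A ** A)))"

definition nuclear_norm :: "real^'n^'m \<Rightarrow> real" where
  "nuclear_norm A = sum_mset (singular_values A)"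

datatype norm_kind = Frob | Oper | Nuc

fun matrix_norm :: "norm_kind \<Rightarrow> real^'n^'m \<Rightarrow> real" where
  "matrix_norm Frob A = frobenius_norm A"
| "matrix_norm Oper A = operator_norm A"
| "matrix_norm Nuc A = nuclear_norm A"

definition spike_cos :: "real \<Rightarrow> real" where
  "spike_cos \<rho> = sqrt (\<rho> / (1 + \<rho>))"

definition spike_sin :: "real \<Rightarrow> real" where
  "spike_sin \<rho> = sqrt (1 / (1 + \<rho>))"

definition loss_matrix :: "real \<Rightarrow> real \<Rightarrow> real^2^2" where
  "loss_matrix \<rho> \<theta> =
     vector [vector [\<rho> - \<theta> * (spike_cos \<rho>)\<^sup>2, - \<theta> * spike_cos \<rho> * spike_sin \<rho>],
             vector [- \<theta> * spike_cos \<rho> * spike_sin \<rho>, - \<theta> * (spike_sin \<rho>)\<^sup>2]]"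

definition asymp_loss :: "norm_kind \<Rightarrow> real \<Rightarrow> real \<Rightarrow> real" where
  "asymp_loss k \<rho> \<theta> = matrix_norm k (loss_matrix \<rho> \<theta>)"

text \<open>\<open>LEAST\<close> expresses a genuine minimum; it is specified only if the minimum is attained.\<close>

definition optimal_loss :: "norm_kind \<Rightarrow> real \<Rightarrow> real" where
  "optimal_loss k \<rho> = (LEAST l. \<exists>\<theta>. l = asymp_loss k \<rho> \<theta>)"

fun optimal_shrinker :: "norm_kind \<Rightarrow> real \<Rightarrow> real" where
  "optimal_shrinker Frob \<rho> = \<rho>\<^sup>2 / (1 + \<rho>)"
| "optimal_shrinker Oper \<rho> = \<rho>"
| "optimal_shrinker Nuc \<rho> = \<rho> * max ((\<rho> - 1) / (\<rho> + 1)) 0"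

end

theory Submission
  imports Defs
begin

text \<open>
  The entries of the \<open>2 \<times> 2\<close> loss matrix \<open>M\<close> give
  \<open>\<parallel>M\<parallel>\<^sub>F\<^sup>2 = \<rho>\<^sup>2 + \<theta>\<^sup>2 - 2 \<rho>\<^sup>2 \<theta> / (1 + \<rho>)\<close> and \<open>det M = - \<rho> \<theta> / (1 + \<rho>)\<close>. The Frobenius case is
  completion of the square. The nuclear case is too, piecewise in the sign of \<open>\<theta>\<close>, because singular
  values satisfy \<open>(\<sigma>\<^sub>1 + \<sigma>\<^sub>2)\<^sup>2 = \<parallel>M\<parallel>\<^sub>F\<^sup>2 + 2 \<bar>det M\<bar>\<close>. For the operator norm, the first column of
  \<open>M\<close> has squared length \<open>(\<rho>\<^sup>2 + \<rho> (\<theta> - \<rho>)\<^sup>2) / (1 + \<rho>)\<close>, a lower bound minimal at \<open>\<theta> = \<rho>\<close>; there \<open>M\<close> is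
  a multiple of an orthogonal matrix, so the bound is attained.
\<close>

lemma frobenius_norm_2:
  fixes A :: "real^2^2"
  shows "(frobenius_norm A)\<^sup>2 = (A$1$1)\<^sup>2 + (A$1$2)\<^sup>2 + (A$2$1)\<^sup>2 + (A$2$2)\<^sup>2"
  by (simp add: frobenius_norm_def sum_2)

lemma charpoly_2:
  fixes A :: "real^2^2"
  shows "charpoly A = [:det A, - trace A, 1:]"
  by (simp add: charpoly_def det_2 trace_def sum_2)

text \<open>The squared singular values are the roots \<open>a\<close>, \<open>b\<close> of the
  characteristic polynomial of \<open>transpose A ** A\<close>. Their sum is its trace, the squared
  Frobenius norm, and their product is \<open>(det A)\<^sup>2\<close>, so
  \<open>sqrt (a * b)\<close> is the absolute value of \<open>det A\<close>.\<close>

lemma nuclear_norm_2: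
  fixes A :: "real^2^2"
  shows "nuclear_norm A = sqrt ((frobenius_norm A)\<^sup>2 + 2 * \<bar>det A\<bar>)"
proof -
  let ?B = "transpose A ** A"
  define t where "t = trace ?B"
  define d where "d = det A"
  have t_frob: "t = (frobenius_norm A)\<^sup>2"
    unfolding frobenius_norm_2 t_def
    by (simp add: trace_def sum_2 matrix_matrix_mult_def transpose_def power2_eq_square)
  have det_B: "det ?B = d\<^sup>2"
    by (simp add: det_mul power2_eq_square d_def)
  \<comment> \<open>Writing both factors of \<open>t\<^sup>2 - 4 * d\<^sup>2\<close> as sums of
    squares shows that the discriminant is nonnegative, so the quadratic has real roots.\<close>
  have "t - 2 * d = (A$1$1 - A$2$2)\<^sup>2 + (A$1$2 + A$2$1)\<^sup>2"
    "t + 2 * d = (A$1$1 + A$2$2)\<^sup>2 + (A$1$2 - A$2$1)\<^sup>2"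
    unfolding t_frob frobenius_norm_2 d_def det_2 by (simp_all add: power2_eq_square algebra_simps)
  then have bounds: "0 \<le> t - 2 * d" "0 \<le> t + 2 * d"
    by simp_all
  then have "0 \<le> (t - 2 * d) * (t + 2 * d)"
    by simp
  then have disc: "4 * d\<^sup>2 \<le> t\<^sup>2"
    by (simp add: algebra_simps power2_eq_square)
  have t_nonneg: "0 \<le> t"
    by (simp add: t_frob)
  define r where "r = sqrt (t\<^sup>2 - 4 * d\<^sup>2)"
  have r_sq: "r\<^sup>2 = t\<^sup>2 - 4 * d\<^sup>2"
    using disc by (simp add: r_def)
  have r_nonneg: "0 \<le> r"
    using disc by (simp add: r_def)
  have r_le: "r \<le> t"
    unfolding r_def using t_nonneg by (intro real_le_lsqrt) simp_all
  define a b where "a = (t + r) / 2" and "b = (t - r) / 2"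
  have ab: "0 \<le> a" "0 \<le> b" "a + b = t"
    using r_nonneg r_le by (auto simp: a_def b_def field_simps)
  have prod_ab: "a * b = d\<^sup>2"
    using r_sq by (simp add: a_def b_def field_simps power2_eq_square)
  have "charpoly ?B = [:- a, 1:] * [:- b, 1:]"
    unfolding charpoly_2 using ab prod_ab by (simp add: det_B mult.commute flip: t_def)
  then have "proots (charpoly ?B) = {#a, b#}"
    \<comment> \<open>The product must stay unexpanded for \<open>proots_mult\<close> to split it
      into linear factors.\<close>
    by (simp add: proots_mult proots_linear_factor del: mult_pCons_left mult_pCons_right)
  then have nuc: "nuclear_norm A = sqrt a + sqrt b"
    by (simp add: nuclear_norm_def singular_values_def)
  have "(sqrt a + sqrt b)\<^sup>2 = a + b + 2 * sqrt (a * b)"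
    using ab by (simp add: power2_sum real_sqrt_mult)
  also have "\<dots> = t + 2 * \<bar>d\<bar>"
    by (simp add: ab prod_ab)
  finally show ?thesis
    unfolding nuc using ab by (simp add: t_frob d_def real_sqrt_unique)
qed

lemma loss_matrix_nth:
  "loss_matrix \<rho> \<theta> $ 1 $ 1 = \<rho> - \<theta> * (spike_cos \<rho>)\<^sup>2"
  "loss_matrix \<rho> \<theta> $ 1 $ 2 = - \<theta> * spike_cos \<rho> * spike_sin \<rho>"
  "loss_matrix \<rho> \<theta> $ 2 $ 1 = - \<theta> * spike_cos \<rho> * spike_sin \<rho>"
  "loss_matrix \<rho> \<theta> $ 2 $ 2 = - \<theta> * (spike_sin \<rho>)\<^sup>2"
  by (simp_all add: loss_matrix_def)

context
  fixes \<rho> :: real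
  assumes pos: "\<rho> > 0"
begin

lemma spike_squares: "(spike_cos \<rho>)\<^sup>2 = \<rho> / (1 + \<rho>)" "(spike_sin \<rho>)\<^sup>2 = 1 / (1 + \<rho>)"
  using pos by (simp_all add: spike_cos_def spike_sin_def)

text \<open>With the unit vector \<open>u = (spike_cos \<rho>, spike_sin \<rho>)\<close>, the loss
  matrix is \<rho> times the projection onto the first axis minus \<theta> times the projection onto
  \<open>u\<close>. The Frobenius inner product of the two projections is
  \<open>(spike_cos \<rho>)\<^sup>2\<close>, which gives the cross term.\<close>

lemma frobenius_loss_sq:
  "(frobenius_norm (loss_matrix \<rho> \<theta>))\<^sup>2 = \<rho>\<^sup>2 + \<theta>\<^sup>2 - 2 * \<rho>\<^sup>2 * \<theta> / (1 + \<rho>)"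
  using pos unfolding frobenius_norm_2 loss_matrix_nth power_mult_distrib power2_minus spike_squares
  by (simp add: divide_simps) algebra

text \<open>The part quadratic in \<theta> cancels because the subtracted matrix has rank
  one.\<close>

lemma det_loss: "det (loss_matrix \<rho> \<theta>) = - \<rho> * \<theta> / (1 + \<rho>)"
proof -
  have "det (loss_matrix \<rho> \<theta>)
      = - ((\<rho> - \<theta> * (spike_cos \<rho>)\<^sup>2) * \<theta> * (spike_sin \<rho>)\<^sup>2) - \<theta>\<^sup>2 * (spike_cos \<rho>)\<^sup>2 * (spike_sin \<rho>)\<^sup>2"
    by (simp add: det_2 loss_matrix_nth power2_eq_square)
  also have "\<dots> = - \<rho> * \<theta> / (1 + \<rho>)"
    using pos unfolding spike_squares by (simp add: divide_simps) algebra
  finally show ?thesis .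
qed

lemma frobenius_loss_min:
  "frobenius_norm (loss_matrix \<rho> (\<rho>\<^sup>2 / (1 + \<rho>))) \<le> frobenius_norm (loss_matrix \<rho> \<theta>)"
proof (rule power2_le_imp_le)
  have "(frobenius_norm (loss_matrix \<rho> \<theta>))\<^sup>2 - (frobenius_norm (loss_matrix \<rho> (\<rho>\<^sup>2 / (1 + \<rho>))))\<^sup>2
      = (\<theta> - \<rho>\<^sup>2 / (1 + \<rho>))\<^sup>2"
    unfolding frobenius_loss_sq by (simp add: power2_eq_square algebra_simps)
  then show "(frobenius_norm (loss_matrix \<rho> (\<rho>\<^sup>2 / (1 + \<rho>))))\<^sup>2 \<le> (frobenius_norm (loss_matrix \<rho> \<theta>))\<^sup>2"
    by (metis diff_ge_0_iff_ge zero_le_power2)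
qed (simp add: frobenius_norm_def sum_nonneg)

lemma frobenius_loss_value:
  "(frobenius_norm (loss_matrix \<rho> (\<rho>\<^sup>2 / (1 + \<rho>))))\<^sup>2 = \<rho>\<^sup>2 * (2 * \<rho> + 1) / (\<rho> + 1)\<^sup>2"
  using pos unfolding frobenius_loss_sq by (simp add: divide_simps) algebra

lemma operator_loss_ge: "\<rho> / sqrt (1 + \<rho>) \<le> operator_norm (loss_matrix \<rho> \<theta>)"
proof -
  let ?M = "loss_matrix \<rho> \<theta>"
  have "(norm (?M *v axis 1 1))\<^sup>2 = (?M$1$1)\<^sup>2 + (?M$2$1)\<^sup>2"
    by (simp add: norm_vec_def L2_set_def sum_2 matrix_vector_mul_component inner_axis)
  also have "\<dots> = (\<rho>\<^sup>2 + \<rho> * (\<theta> - \<rho>)\<^sup>2) / (1 + \<rho>)"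
    using pos unfolding loss_matrix_nth power_mult_distrib power2_minus spike_squares
    by (simp add: divide_simps) algebra
  also have "\<dots> \<ge> \<rho>\<^sup>2 / (1 + \<rho>)"
    using pos by (intro divide_right_mono) auto
  finally have "(\<rho> / sqrt (1 + \<rho>))\<^sup>2 \<le> (norm (?M *v axis 1 1))\<^sup>2"
    using pos by (simp add: power_divide)
  then have "\<rho> / sqrt (1 + \<rho>) \<le> norm (?M *v axis 1 1)"
    by (rule power2_le_imp_le) simp
  also have "\<dots> \<le> operator_norm ?M * norm (axis 1 1 :: real^2)"
    unfolding operator_norm_def by (rule onorm) (rule matrix_vector_mul_bounded_linear)
  finally show ?thesis
    by (simp add: norm_axis_1)
qed

lemma operator_loss_le: "operator_norm (loss_matrix \<rho> \<rho>) \<le> \<rho> / sqrt (1 + \<rho>)"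
  unfolding operator_norm_def
proof (rule onorm_le)
  fix v :: "real^2"
  let ?M = "loss_matrix \<rho> \<rho>"
  let ?q = "\<rho> * spike_cos \<rho> * spike_sin \<rho>"
  \<comment> \<open>Since \<open>\<rho> - \<rho> * (spike_cos \<rho>)\<^sup>2 = \<rho> * (spike_sin
    \<rho>)\<^sup>2\<close>, the diagonal entries are opposite. A symmetric matrix of trace zero
    squares to a scalar matrix, so the cross terms below cancel and every vector is stretched by the
    same factor.\<close>
  have entries: "?M$1$1 = \<rho> / (1 + \<rho>)" "?M$1$2 = - ?q" "?M$2$1 = - ?q" "?M$2$2 = - (\<rho> / (1 + \<rho>))"
    using pos unfolding loss_matrix_nth spike_squares by (simp_all add: field_simps)
  have "?q\<^sup>2 = \<rho>^3 / (1 + \<rho>)\<^sup>2"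
    unfolding power_mult_distrib spike_squares by (simp add: power2_eq_square power3_eq_cube)
  moreover have "(\<rho> / (1 + \<rho>))\<^sup>2 + \<rho>^3 / (1 + \<rho>)\<^sup>2 = \<rho>\<^sup>2 / (1 + \<rho>)"
    using pos by (simp add: divide_simps) algebra
  ultimately have scale: "(\<rho> / (1 + \<rho>))\<^sup>2 + ?q\<^sup>2 = \<rho>\<^sup>2 / (1 + \<rho>)"
    by simp
  have "(norm (?M *v v))\<^sup>2 = (?M$1$1 * v$1 + ?M$1$2 * v$2)\<^sup>2 + (?M$2$1 * v$1 + ?M$2$2 * v$2)\<^sup>2"
    by (simp add: norm_vec_def L2_set_def sum_2 matrix_vector_mult_def)
  also have "\<dots> = ((\<rho> / (1 + \<rho>))\<^sup>2 + ?q\<^sup>2) * ((v$1)\<^sup>2 + (v$2)\<^sup>2)"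
    unfolding entries by algebra
  also have "\<dots> = (\<rho> / sqrt (1 + \<rho>) * norm v)\<^sup>2"
    using pos unfolding scale
    by (simp add: norm_vec_def L2_set_def sum_2 power_mult_distrib power_divide)
  finally have "norm (?M *v v) = \<rho> / sqrt (1 + \<rho>) * norm v"
    using pos by (subst (asm) power2_eq_iff_nonneg) auto
  then show "norm (?M *v v) \<le> \<rho> / sqrt (1 + \<rho>) * norm v"
    by simp
qed

lemma nuclear_loss:
  "nuclear_norm (loss_matrix \<rho> \<theta>)
    = sqrt (\<rho>\<^sup>2 + \<theta>\<^sup>2 - 2 * \<rho>\<^sup>2 * \<theta> / (1 + \<rho>) + 2 * \<rho> * \<bar>\<theta>\<bar> / (1 + \<rho>))"
  using pos by (simp add: nuclear_norm_2 frobenius_loss_sq det_loss abs_mult)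

lemma nuclear_loss_value:
  "nuclear_norm (loss_matrix \<rho> (\<rho> * max ((\<rho> - 1) / (\<rho> + 1)) 0))
    = (if \<rho> \<le> 1 then \<rho> else 2 * \<rho> * sqrt \<rho> / (\<rho> + 1))"
proof (cases "\<rho> \<le> 1")
  \<comment> \<open>The shrinker vanishes here, so the only nonzero entry of the loss matrix is
    \<rho>.\<close>
  case True
  then have "(\<rho> - 1) / (\<rho> + 1) \<le> 0"
    using pos by (simp add: divide_simps)
  then show ?thesis
    using pos True by (simp add: nuclear_loss max_def)
next
  case False
  define \<theta> where "\<theta> = \<rho> * ((\<rho> - 1) / (\<rho> + 1))"
  have \<theta>: "0 \<le> \<theta>" "max ((\<rho> - 1) / (\<rho> + 1)) 0 = (\<rho> - 1) / (\<rho> + 1)"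
    using False by (simp_all add: \<theta>_def)
  have "\<rho>\<^sup>2 + \<theta>\<^sup>2 - 2 * \<rho>\<^sup>2 * \<theta> / (1 + \<rho>) + 2 * \<rho> * \<theta> / (1 + \<rho>) = 4 * \<rho>^3 / (\<rho> + 1)\<^sup>2"
    using pos unfolding \<theta>_def by (simp add: divide_simps) algebra
  also have "\<dots> = (2 * \<rho> * sqrt \<rho> / (\<rho> + 1))\<^sup>2"
    using pos by (simp add: power_divide power_mult_distrib power2_eq_square power3_eq_cube)
  finally have "nuclear_norm (loss_matrix \<rho> \<theta>) = 2 * \<rho> * sqrt \<rho> / (\<rho> + 1)"
    unfolding nuclear_loss using pos \<theta>(1) by simp
  then show ?thesis
    using False by (simp add: \<theta>(2) \<theta>_def)
qed

lemma nuclear_loss_ge: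
  "(if \<rho> \<le> 1 then \<rho> else 2 * \<rho> * sqrt \<rho> / (\<rho> + 1)) \<le> nuclear_norm (loss_matrix \<rho> \<theta>)"
proof -
  \<comment> \<open>For \<theta> \<ge> 0 the squared nuclear loss is a quadratic in \<theta> with
    vertex \<open>\<rho> * m\<close>; for negative \<theta> that quadratic is still a lower
    bound.\<close>
  define m where "m = (\<rho> - 1) / (\<rho> + 1)"
  let ?X = "\<rho>\<^sup>2 + \<theta>\<^sup>2 - 2 * \<rho>\<^sup>2 * \<theta> / (1 + \<rho>) + 2 * \<rho> * \<bar>\<theta>\<bar> / (1 + \<rho>)"
  have "- (2 * \<rho>\<^sup>2 * \<theta> / (1 + \<rho>)) + 2 * \<rho> * \<theta> / (1 + \<rho>) = - (2 * \<rho> * m * \<theta>)"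
    using pos unfolding m_def
    by (simp add: add.commute[of \<rho> 1] power2_eq_square algebra_simps diff_divide_distrib)
  moreover have "2 * \<rho> * \<theta> / (1 + \<rho>) \<le> 2 * \<rho> * \<bar>\<theta>\<bar> / (1 + \<rho>)"
    using pos by (intro divide_right_mono mult_left_mono) auto
  ultimately have lower: "\<rho>\<^sup>2 + \<theta>\<^sup>2 - 2 * \<rho> * m * \<theta> \<le> ?X"
    by linarith
  show ?thesis
  proof (cases "\<rho> \<le> 1")
    case True
    \<comment> \<open>For \<rho> < 1 the vertex is negative and the minimum of the quadratic lies
      below \<open>\<rho>\<^sup>2\<close>, so \<open>lower\<close> is too weak. Instead the two
      terms of \<open>?X\<close> that are linear in \<theta> and its absolute value have a
      nonnegative sum.\<close>
    have "\<rho> * \<theta> \<le> \<rho> * \<bar>\<theta>\<bar>"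
      using pos by (intro mult_left_mono) auto
    also have "\<dots> \<le> \<bar>\<theta>\<bar>"
      using True pos by (intro mult_left_le_one_le) auto
    finally have "\<rho>\<^sup>2 * \<theta> \<le> \<rho> * \<bar>\<theta>\<bar>"
      using pos by (simp add: power2_eq_square)
    then have "2 * \<rho>\<^sup>2 * \<theta> / (1 + \<rho>) \<le> 2 * \<rho> * \<bar>\<theta>\<bar> / (1 + \<rho>)"
      using pos by (intro divide_right_mono) auto
    then have "\<rho>\<^sup>2 \<le> ?X"
      using zero_le_power2[of \<theta>] by linarith
    then show ?thesis
      unfolding nuclear_loss using True by (simp add: real_le_rsqrt)
  next
    case False
    have "(2 * \<rho> * sqrt \<rho> / (\<rho> + 1))\<^sup>2 = 4 * \<rho>^3 / (\<rho> + 1)\<^sup>2"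
      using pos by (simp add: power_divide power_mult_distrib power2_eq_square power3_eq_cube)
    also have "\<dots> = \<rho>\<^sup>2 - (\<rho> * m)\<^sup>2"
      using pos unfolding m_def by (simp add: divide_simps) algebra
    also have "\<dots> \<le> \<rho>\<^sup>2 + \<theta>\<^sup>2 - 2 * \<rho> * m * \<theta>"
      using zero_le_power2[of "\<theta> - \<rho> * m"] by (simp add: power2_diff algebra_simps)
    finally show ?thesis
      unfolding nuclear_loss using False lower by (simp add: real_le_rsqrt)
  qed
qed

lemma asymp_loss_min: "asymp_loss k \<rho> (optimal_shrinker k \<rho>) \<le> asymp_loss k \<rho> \<theta>"
proof (cases k)
  case Frob
  then show ?thesis
    using frobenius_loss_min by (simp add: asymp_loss_def)
next
  case Oper
  then show ?thesis
    using order_trans[OF operator_loss_le operator_loss_ge] by (simp add: asymp_loss_def)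
next
  case Nuc
  then show ?thesis
    using nuclear_loss_ge by (simp add: asymp_loss_def nuclear_loss_value)
qed

text \<open>Attainment at the shrinker is what gives the \<open>LEAST\<close> in
  \<open>optimal_loss\<close> its intended value.\<close>

lemma optimal_loss_eq: "optimal_loss k \<rho> = asymp_loss k \<rho> (optimal_shrinker k \<rho>)"
  unfolding optimal_loss_def by (rule Least_equality) (auto intro: asymp_loss_min)

end

theorem lemma4p3:
  fixes \<rho> :: real
  assumes "\<rho> > 0"
  shows "(\<forall>k. optimal_loss k \<rho> = asymp_loss k \<rho> (optimal_shrinker k \<rho>) \<and>
              (\<forall>\<theta>. asymp_loss k \<rho> (optimal_shrinker k \<rho>) \<le> asymp_loss k \<rho> \<theta>)) \<and>
         (optimal_loss Frob \<rho>)\<^sup>2 = \<rho>\<^sup>2 * (2 * \<rho> + 1) / (\<rho> + 1)\<^sup>2 \<and>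
         optimal_loss Oper \<rho> = \<rho> / sqrt (1 + \<rho>) \<and>
         optimal_loss Nuc \<rho> = (if \<rho> \<le> 1 then \<rho> else 2 * \<rho> * sqrt \<rho> / (\<rho> + 1))"
proof (intro conjI allI)
  show "optimal_loss Oper \<rho> = \<rho> / sqrt (1 + \<rho>)"
    \<comment> \<open>The lower bound is taken at the shrinker \<rho> itself, so the two
      inequalities meet.\<close>
    using operator_loss_le[OF assms] operator_loss_ge[OF assms, of \<rho>]
    by (simp add: optimal_loss_eq[OF assms] asymp_loss_def)
  show "(optimal_loss Frob \<rho>)\<^sup>2 = \<rho>\<^sup>2 * (2 * \<rho> + 1) / (\<rho> + 1)\<^sup>2"
    using frobenius_loss_value[OF assms] by (simp add: optimal_loss_eq[OF assms] asymp_loss_def)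
  show "optimal_loss Nuc \<rho> = (if \<rho> \<le> 1 then \<rho> else 2 * \<rho> * sqrt \<rho> / (\<rho> + 1))"
    using nuclear_loss_value[OF assms] by (simp add: optimal_loss_eq[OF assms] asymp_loss_def)
qed (use optimal_loss_eq asymp_loss_min assms in auto)

end
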